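(* Let $C_m$ be a cycle on $m$ vertices and $K_n$ a complete graph on $n$ vertices. Then the sparing number of the edge corona $C_m\diamond K_n$ is $\frac{1}{2}mn(n+1)$.
   Context: All graphs are simple, finite and have no isolated vertices. $\mathbb{N}_0$ is the set of non-negative integers, $\mathcal{P}(\mathbb{N}_0)$ is its power set, and the sum set of $A,B\subseteq\mathbb{N}_0$ is $A+B=\{a+b: a\in A,\ b\in B\}$. All sets used as labels are finite. An integer additive set-indexer (IASI) of a graph $G$ is an injective function $f:V(G)\to\mathcal{P}(\mathbb{N}_0)$ such that the induced function $f^+:E(G)\to\mathcal{P}(\mathbb{N}_0)$, $f^+(uv)=f(u)+f(v)$, is also injective. It is a weak IASI if $|f^+(uv)|=\max(|f(u)|,|f(v)|)$ for every edge $uv\in E(G)$. An edge $e$ is mono-indexed if $|f^+(e)|=1$. The sparing number $\varphi(G)$ is the minimum number of mono-indexed edges required for $G$ to admit a weak IASI, i.e. the minimum of the number of mono-indexed edges over all weak IASIs of $G$. Edge corona: if $G_1$ has $m_1$ edges, $G_1\diamond G_2$ is the graph obtained from $G_1$ by taking $m_1$ disjoint copies of $G_2$ (one for each edge of $G_1$) and joining both end vertices of the $i$-th edge of $G_1$ to every vertex of the $i$-th copy of $G_2$. *)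

theory Defs
  imports Complex_Main "HOL-Library.Set_Algebras"
begin

text \<open>An edge is the two-element set of its ends.\<close>

record 'a graph =
  verts :: "'a set"
  edges :: "'a set set"

definition is_cycle :: "nat \<Rightarrow> 'a graph \<Rightarrow> bool" where
  "is_cycle m G \<longleftrightarrow> m \<ge> 3 \<and>
     (\<exists>c. bij_betw c {..<m} (verts G) \<and>
          edges G = {{c i, c (Suc i mod m)} | i. i < m})"

definition is_complete :: "nat \<Rightarrow> 'a graph \<Rightarrow> bool" where
  "is_complete n G \<longleftrightarrow> finite (verts G) \<and> card (verts G) = n \<and>
     edges G = {e. e \<subseteq> verts G \<and> card e = 2}"

text \<open>The vertex \<open>Inr (e, x)\<close> is the vertex \<open>x\<close> of the copy of \<open>H\<close> that
  belongs to the edge \<open>e\<close> of \<open>G\<close>.\<close>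

definition edge_corona :: "'a graph \<Rightarrow> 'b graph \<Rightarrow> ('a + 'a set \<times> 'b) graph" where
  "edge_corona G H =
     \<lparr> verts = Inl ` verts G \<union> Inr ` (edges G \<times> verts H),
       edges = {Inl ` e | e. e \<in> edges G}
             \<union> {(\<lambda>x. Inr (e, x)) ` d | e d. e \<in> edges G \<and> d \<in> edges H}
             \<union> {{Inl v, Inr (e, x)} | v e x. e \<in> edges G \<and> v \<in> e \<and> x \<in> verts H} \<rparr>"

text \<open>On sets, \<open>+\<close> is the sum set operation. The union ranges over the two
  orderings of the ends of the edge, which give the same sum set.\<close>

definition edge_label :: "('a \<Rightarrow> nat set) \<Rightarrow> 'a set \<Rightarrow> nat set" where
  "edge_label f e = \<Union> {f u + f v | u v. e = {u, v}}"

lemma edge_label_pair: "edge_label f {u, v} = f u + f v"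
proof -
  have "{f a + f b | a b. {u, v} = {a, b}} = {f u + f v}"
    by (auto simp: doubleton_eq_iff add.commute)
  then show ?thesis
    by (simp add: edge_label_def)
qed

definition iasi :: "'a graph \<Rightarrow> ('a \<Rightarrow> nat set) \<Rightarrow> bool" where
  "iasi G f \<longleftrightarrow> (\<forall>v\<in>verts G. finite (f v)) \<and>
     inj_on f (verts G) \<and> inj_on (edge_label f) (edges G)"

definition weak_iasi :: "'a graph \<Rightarrow> ('a \<Rightarrow> nat set) \<Rightarrow> bool" where
  "weak_iasi G f \<longleftrightarrow> iasi G f \<and>
     (\<forall>u v. {u, v} \<in> edges G \<longrightarrow>
        card (edge_label f {u, v}) = max (card (f u)) (card (f v)))"

definition mono_indexed_edges :: "'a graph \<Rightarrow> ('a \<Rightarrow> nat set) \<Rightarrow> 'a set set" where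
  "mono_indexed_edges G f = {e \<in> edges G. card (edge_label f e) = 1}"

text \<open>For a nonempty set of natural numbers \<open>Inf\<close> is the minimum; \<open>Inf {} = 0\<close>,
  so a positive value is always attained by some weak IASI.\<close>

definition sparing_number :: "'a graph \<Rightarrow> nat" where
  "sparing_number G = Inf {card (mono_indexed_edges G f) | f. weak_iasi G f}"

end

theory Submission
  imports Defs "HOL-Library.Nat_Bijection"
begin

text \<open>In a weak IASI no label is empty on an edge, and a sum set is strictly larger than
  both summands as soon as both have two elements. So the vertices with a label of at least
  two elements form an independent set, and an edge is mono-indexed exactly when it avoids
  that set. Conversely, in a finite graph the edges avoiding a given independent set
  are the mono-indexed edges of some weak IASI (\<open>ex_weak_iasi_independent\<close>).
  So computing a sparing number means choosing an independent set that leaves as few edges as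
  possible untouched.

  Each edge \<open>e\<close> of \<open>G\<close> spans, together with its copy of \<open>K\<^sub>n\<close>, a clique on
  \<open>n + 2\<close> vertices, and these cliques partition the edges of \<open>G \<diamond> K\<^sub>n\<close>
  (\<open>edges_edge_corona_complete\<close>, \<open>disjoint_corona_cliques\<close>). An independent set
  meets each clique at most once and so leaves at least
  \<open>(n + 1 choose 2)\<close> of its edges mono-indexed. Equality holds in all cliques
  simultaneously when one vertex is chosen in every copy of \<open>K\<^sub>n\<close>, because vertices of
  different copies are never adjacent. Therefore the sparing number of \<open>G \<diamond> K\<^sub>n\<close> is
  \<open>|E(G)| (n + 1 choose 2)\<close> for every finite \<open>G\<close> and \<open>n \<ge> 1\<close>,
  and a cycle of length \<open>m\<close> has \<open>m\<close> edges.\<close>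

section \<open>Sizes of sum sets\<close>

text \<open>The translate of \<open>A\<close> by \<open>b\<close> misses the element \<open>Max A + b'\<close> of the sum set.\<close>

lemma card_less_card_set_plus:
  fixes A B :: "nat set"
  assumes "finite A" "A \<noteq> {}" "finite B" "b \<in> B" "b' \<in> B" "b < b'"
  shows "card A < card (A + B)"
proof -
  have "(\<lambda>a. a + b) ` A \<subseteq> A + B"
    using assms by (auto simp: set_plus_def)
  moreover have "Max A + b' \<in> A + B"
    using assms by (intro set_plus_intro Max_in)
  moreover have "Max A + b' \<notin> (\<lambda>a. a + b) ` A"
    using assms(1,6) by (auto dest: Max_ge)
  ultimately have "(\<lambda>a. a + b) ` A \<subset> A + B"
    by blast
  then have "card ((\<lambda>a. a + b) ` A) < card (A + B)"
    using assms by (intro psubset_card_mono finite_set_plus)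
  then show ?thesis
    by (simp add: card_image inj_on_def)
qed

lemma ex_less_if_card_ne_1:
  fixes B :: "nat set"
  assumes "B \<noteq> {}" "card B \<noteq> 1"
  obtains b b' where "b \<in> B" "b' \<in> B" "b < b'"
proof -
  obtain b where b: "b \<in> B"
    using assms by blast
  have "B \<noteq> {b}"
    using assms by auto
  then obtain b' where "b' \<in> B" "b' \<noteq> b"
    using b by blast
  then show ?thesis
    using that b by (meson linorder_neqE_nat)
qed

lemma card_1_if_card_set_plus_eq_max:
  fixes A B :: "nat set"
  assumes fin: "finite A" "finite B" and ne: "A \<noteq> {}" "B \<noteq> {}"
    and card: "card (A + B) = max (card A) (card B)"
  shows "card A = 1 \<or> card B = 1"
proof (rule ccontr)
  assume "\<not> ?thesis"
  then obtain a a' b b' where "a \<in> A" "a' \<in> A" "a < a'" "b \<in> B" "b' \<in> B" "b < b'"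
    using ne ex_less_if_card_ne_1 by metis
  then have "card A < card (A + B)" "card B < card (B + A)"
    using fin ne card_less_card_set_plus by blast+
  then show False
    using card by (simp add: add.commute)
qed

section \<open>Weak labellings and independent sets\<close>

text \<open>An empty label would force the other end of the edge to have an empty label as well,
  against injectivity on vertices.\<close>

lemma weak_iasi_edge:
  assumes f: "weak_iasi G f" and e: "{u, v} \<in> edges G"
    and uv: "u \<in> verts G" "v \<in> verts G" "u \<noteq> v"
  shows "card (f u) = 1 \<or> card (f v) = 1"
proof -
  have fin: "finite (f u)" "finite (f v)"
    using f uv by (auto simp: weak_iasi_def iasi_def)
  have ne: "f u \<noteq> f v"
    using f uv by (auto simp: weak_iasi_def iasi_def inj_on_def)
  have card: "card (f u + f v) = max (card (f u)) (card (f v))"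
    using f e by (auto simp: weak_iasi_def edge_label_pair)
  have "f u \<noteq> {}"
  proof
    assume "f u = {}"
    then have "card (f v) = 0"
      using card by (simp add: set_plus_def)
    then show False
      using fin ne \<open>f u = {}\<close> by simp
  qed
  moreover have "f v \<noteq> {}"
  proof
    assume "f v = {}"
    then have "card (f u) = 0"
      using card by (simp add: set_plus_def)
    then show False
      using fin ne \<open>f v = {}\<close> by simp
  qed
  ultimately show ?thesis
    using fin card by (intro card_1_if_card_set_plus_eq_max)
qed

text \<open>At most one vertex of the clique has a label that is not a singleton; all edges of
  the clique avoiding it are mono-indexed.\<close>

lemma clique_mono_indexed_edges:
  assumes f: "weak_iasi G f" and Q: "finite Q" "Q \<subseteq> verts G" "Q \<noteq> {}"
    and clique: "{d. d \<subseteq> Q \<and> card d = 2} \<subseteq> edges G"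
  shows "(card Q - 1) choose 2 \<le> card {d \<in> mono_indexed_edges G f. d \<subseteq> Q}"
proof -
  obtain q where q: "q \<in> Q" "\<And>v. v \<in> Q - {q} \<Longrightarrow> card (f v) = 1"
  proof (cases "\<exists>q\<in>Q. card (f q) \<noteq> 1")
    case True
    then obtain q where q: "q \<in> Q" "card (f q) \<noteq> 1"
      by blast
    have "card (f v) = 1" if "v \<in> Q - {q}" for v
    proof -
      have "{q, v} \<in> edges G"
        using that q clique by auto
      then show ?thesis
        using weak_iasi_edge[OF f, of q v] q that Q by auto
    qed
    then show thesis
      using that q by blast
  next
    case False
    then show thesis
      using that Q(3) by blast
  qed
  have "d \<in> mono_indexed_edges G f" if d: "d \<subseteq> Q - {q}" "card d = 2" for d
  proof -
    obtain u v where uv: "d = {u, v}" "u \<noteq> v"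
      using d(2) by (auto simp: card_2_iff)
    have "d \<in> edges G"
      using d clique by blast
    moreover have "card (f u) = 1" "card (f v) = 1"
      using q d uv by blast+
    ultimately show ?thesis
      using f uv by (auto simp: mono_indexed_edges_def weak_iasi_def)
  qed
  then have "{d. d \<subseteq> Q - {q} \<and> card d = 2} \<subseteq> {d \<in> mono_indexed_edges G f. d \<subseteq> Q}"
    by blast
  then have "card {d. d \<subseteq> Q - {q} \<and> card d = 2}
      \<le> card {d \<in> mono_indexed_edges G f. d \<subseteq> Q}"
    using Q(1) by (intro card_mono) auto
  then show ?thesis
    using Q(1) q(1) by (simp add: n_subsets)
qed

text \<open>Give the vertex with number \<open>i\<close> the minimum label \<open>2 ^ i\<close>. Minima add under
  sum sets, so by uniqueness of binary expansions the minimum of an edge label determines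
  the edge, however the labels are continued above their minima.\<close>

lemma ex_weak_iasi_independent:
  assumes fin: "finite (verts G)"
    and edge: "\<And>e. e \<in> edges G \<Longrightarrow> e \<subseteq> verts G \<and> card e = 2"
    and indep: "\<And>e. e \<in> edges G \<Longrightarrow> \<not> e \<subseteq> I"
  shows "\<exists>f. weak_iasi G f \<and> mono_indexed_edges G f = {e \<in> edges G. e \<inter> I = {}}"
proof -
  obtain ix :: "'a \<Rightarrow> nat" where ix: "inj_on ix (verts G)"
    using finite_imp_inj_to_nat_seg[OF fin] by blast
  define f where "f v = (if v \<in> I then {2 ^ ix v, Suc (2 ^ ix v)} else {2 ^ ix v})" for v
  have pair: "\<exists>u v. e = {u, v} \<and> u \<in> verts G \<and> v \<in> verts G \<and> u \<noteq> v \<and> v \<notin> I"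
    if "e \<in> edges G" for e
  proof -
    obtain u v where uv: "e = {u, v}" "u \<noteq> v"
      using edge[OF \<open>e \<in> edges G\<close>] by (auto simp: card_2_iff)
    have "u \<in> verts G" "v \<in> verts G"
      using edge[OF that] uv by auto
    moreover have "u \<notin> I \<or> v \<notin> I"
      using indep[OF that] uv by auto
    ultimately show ?thesis
      using uv by (metis insert_commute)
  qed
  have label: "edge_label f {u, v} =
      (if u \<in> I then {2 ^ ix u + 2 ^ ix v, Suc (2 ^ ix u + 2 ^ ix v)} else {2 ^ ix u + 2 ^ ix v})"
    if "v \<notin> I" for u v
    using that by (auto simp: edge_label_pair f_def set_plus_def)
  have min_vertex: "Inf (f v) = 2 ^ ix v" for v
    by (auto simp: f_def cInf_eq_Min)
  have min_edge: "Inf (edge_label f e) = set_encode (ix ` e)" if "e \<in> edges G" for e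
  proof -
    obtain u v where uv: "e = {u, v}" "u \<in> verts G" "v \<in> verts G" "u \<noteq> v" "v \<notin> I"
      using pair[OF \<open>e \<in> edges G\<close>] by blast
    then have "ix u \<noteq> ix v"
      using ix by (auto simp: inj_on_def)
    then show ?thesis
      using uv by (auto simp: label set_encode_def cInf_eq_Min)
  qed
  have inj_verts: "inj_on f (verts G)"
  proof (rule inj_onI)
    fix u v
    assume uv: "u \<in> verts G" "v \<in> verts G" "f u = f v"
    then have "(2::nat) ^ ix u = 2 ^ ix v"
      by (metis min_vertex)
    then show "u = v"
      using ix uv by (auto simp: inj_on_def)
  qed
  have inj_edges: "inj_on (edge_label f) (edges G)"
  proof (rule inj_onI)
    fix d e
    assume de: "d \<in> edges G" "e \<in> edges G" "edge_label f d = edge_label f e"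
    have sub: "d \<subseteq> verts G" "e \<subseteq> verts G"
      using de edge by blast+
    then have "finite (ix ` d)" "finite (ix ` e)"
      using fin finite_subset by blast+
    moreover have "set_encode (ix ` d) = set_encode (ix ` e)"
      using de by (metis min_edge)
    ultimately have "ix ` d = ix ` e"
      by (simp add: set_encode_eq)
    then show "d = e"
      using ix sub by (simp add: inj_on_image_eq_iff)
  qed
  have "card (edge_label f {u, v}) = max (card (f u)) (card (f v))" if "{u, v} \<in> edges G" for u v
  proof -
    have "u \<notin> I \<or> v \<notin> I"
      using indep[OF that] by blast
    then show ?thesis
      using label[of u v] label[of v u] by (auto simp: f_def insert_commute)
  qed
  then have "weak_iasi G f"
    using inj_verts inj_edges by (auto simp: weak_iasi_def iasi_def f_def)
  moreover have "card (edge_label f e) = 1 \<longleftrightarrow> e \<inter> I = {}" if "e \<in> edges G" for e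
    using pair[OF that] by (auto simp: label)
  then have "mono_indexed_edges G f = {e \<in> edges G. e \<inter> I = {}}"
    by (auto simp: mono_indexed_edges_def)
  ultimately show ?thesis
    by blast
qed

section \<open>The clique decomposition of the corona\<close>

definition corona_clique :: "'b graph \<Rightarrow> 'a set \<Rightarrow> ('a + 'a set \<times> 'b) set" where
  "corona_clique H e = Inl ` e \<union> (\<lambda>x. Inr (e, x)) ` verts H"

lemma card_corona_clique:
  assumes "card e = 2" "finite (verts H)"
  shows "finite (corona_clique H e)" "card (corona_clique H e) = card (verts H) + 2"
proof -
  have fin: "finite e"
    using assms(1) card.infinite by fastforce
  show "finite (corona_clique H e)"
    using fin assms by (simp add: corona_clique_def)
  have "card (corona_clique H e) =
      card (Inl ` e :: ('a + 'a set \<times> 'b) set)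
      + card ((\<lambda>x. Inr (e, x)) ` verts H :: ('a + 'a set \<times> 'b) set)"
    unfolding corona_clique_def using fin assms by (intro card_Un_disjoint) auto
  also have "\<dots> = card (verts H) + 2"
    using assms by (simp add: card_image inj_on_def)
  finally show "card (corona_clique H e) = card (verts H) + 2" .
qed

lemma edges_edge_corona_complete:
  assumes G: "\<And>e. e \<in> edges G \<Longrightarrow> card e = 2" and K: "is_complete n K"
  shows "edges (edge_corona G K) = (\<Union>e\<in>edges G. {d. d \<subseteq> corona_clique K e \<and> card d = 2})"
    (is "?L = ?R")
proof
  have K2: "edges K = {d. d \<subseteq> verts K \<and> card d = 2}"
    using K by (simp add: is_complete_def)
  show "?L \<subseteq> ?R"
  proof
    fix d
    assume "d \<in> ?L"
    then consider e where "e \<in> edges G" "d = Inl ` e"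
      | e d' where "e \<in> edges G" "d' \<in> edges K" "d = (\<lambda>x. Inr (e, x)) ` d'"
      | v e x where "e \<in> edges G" "v \<in> e" "x \<in> verts K" "d = {Inl v, Inr (e, x)}"
      by (auto simp: edge_corona_def)
    then have "\<exists>e\<in>edges G. d \<subseteq> corona_clique K e \<and> card d = 2"
    proof cases
      case 1
      then show ?thesis
        using G by (intro bexI[of _ e]) (auto simp: corona_clique_def card_image)
    next
      case 2
      then show ?thesis
        using K2 by (intro bexI[of _ e]) (auto simp: corona_clique_def card_image inj_on_def)
    next
      case 3
      then show ?thesis
        by (intro bexI[of _ e]) (auto simp: corona_clique_def)
    qed
    then show "d \<in> ?R"
      by blast
  qed
  show "?R \<subseteq> ?L"
  proof
    fix d
    assume "d \<in> ?R"
    then obtain e where e: "e \<in> edges G" "d \<subseteq> corona_clique K e" "card d = 2"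
      by blast
    then obtain p q where pq: "d = {p, q}" "p \<noteq> q"
      by (auto simp: card_2_iff)
    have ends: "p \<in> corona_clique K e" "q \<in> corona_clique K e"
      using e pq by auto
    consider u v where "p = Inl u" "q = Inl v" "u \<in> e" "v \<in> e"
      | x y where "p = Inr (e, x)" "q = Inr (e, y)" "x \<in> verts K" "y \<in> verts K"
      | u x where "d = {Inl u, Inr (e, x)}" "u \<in> e" "x \<in> verts K"
    proof (cases p; cases q)
      fix u v
      assume "p = Inl u" "q = Inl v"
      then show thesis
        using that(1) ends by (auto simp: corona_clique_def)
    next
      fix u y
      assume "p = Inl u" "q = Inr y"
      then show thesis
        using that(3) ends pq(1) by (auto simp: corona_clique_def)
    next
      fix y u
      assume "p = Inr y" "q = Inl u"
      then show thesis
        using that(3) ends pq(1) by (auto simp: corona_clique_def insert_commute)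
    next
      fix y z
      assume "p = Inr y" "q = Inr z"
      then show thesis
        using that(2) ends by (auto simp: corona_clique_def)
    qed
    then show "d \<in> ?L"
    proof cases
      case 1
      have "{u, v} \<subseteq> e" "card {u, v} = card e" "finite e"
        using 1 pq G[OF e(1)] card.infinite[of e] by fastforce+
      then have "{u, v} = e"
        by (metis card_subset_eq)
      then have "d = Inl ` e"
        using 1 pq by auto
      then show ?thesis
        using e by (auto simp: edge_corona_def)
    next
      case 2
      have "{x, y} \<in> edges K"
        using 2 pq K2 by auto
      moreover have "d = (\<lambda>z. Inr (e, z)) ` {x, y}"
        using 2 pq by auto
      ultimately show ?thesis
        using e unfolding edge_corona_def by auto
    next
      case 3
      then show ?thesis
        using e by (auto simp: edge_corona_def)
    qed
  qed
qed

text \<open>Two cliques share only common end vertices of two different edges of \<open>G\<close>, and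
  there is at most one such vertex.\<close>

lemma disjoint_corona_cliques:
  assumes "card e = 2" "card e' = 2" "e \<noteq> e'" "card d = 2"
    and "d \<subseteq> corona_clique H e" "d \<subseteq> corona_clique H e'"
  shows False
proof -
  have "d \<subseteq> Inl ` (e \<inter> e')"
    using assms(3,5,6) by (auto simp: corona_clique_def)
  moreover have fin: "finite e" "finite e'"
    using assms(1,2) card.infinite by fastforce+
  ultimately have "card d \<le> card (e \<inter> e')"
    by (metis surj_card_le finite_Int)
  then have "card (e \<inter> e') \<ge> card e" "card (e \<inter> e') \<ge> card e'"
    using assms by simp_all
  then have "e \<inter> e' = e" "e \<inter> e' = e'"
    using fin by (metis card_seteq inf_le1 inf_le2)+
  then show False
    using assms(3) by simp
qed

section \<open>Sparing numbers\<close>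

theorem sparing_number_edge_corona_complete:
  assumes fin: "finite (verts G)"
    and G: "\<And>e. e \<in> edges G \<Longrightarrow> e \<subseteq> verts G \<and> card e = 2"
    and K: "is_complete n K" and n: "n \<ge> 1"
  shows "sparing_number (edge_corona G K) = card (edges G) * (Suc n choose 2)"
proof -
  let ?H = "edge_corona G K" and ?Q = "corona_clique K"
  have finE: "finite (edges G)"
    using fin G by (intro finite_subset[of "edges G" "Pow (verts G)"]) auto
  have VK: "finite (verts K)" "card (verts K) = n"
    using K by (auto simp: is_complete_def)
  have Q: "finite (?Q e)" "card (?Q e) = n + 2" if "e \<in> edges G" for e
    using card_corona_clique G[OF that] VK by metis+
  have edges: "edges ?H = (\<Union>e\<in>edges G. {d. d \<subseteq> ?Q e \<and> card d = 2})"
    using G K by (intro edges_edge_corona_complete) auto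
  have QV: "?Q e \<subseteq> verts ?H" if "e \<in> edges G" for e
    using that G[OF that] by (auto simp: corona_clique_def edge_corona_def)
  have finV: "finite (verts ?H)"
    using fin finE VK by (simp add: edge_corona_def)
  have finEH: "finite (edges ?H)"
    unfolding edges using finE Q(1) by auto
  have lower: "card (edges G) * (Suc n choose 2) \<le> card (mono_indexed_edges ?H f)"
    if f: "weak_iasi ?H f" for f
  proof -
    let ?M = "\<lambda>e. {d \<in> mono_indexed_edges ?H f. d \<subseteq> ?Q e}"
    have finM: "finite (mono_indexed_edges ?H f)"
      using finEH by (simp add: mono_indexed_edges_def)
    have card2: "card d = 2" if "d \<in> mono_indexed_edges ?H f" for d
      using that edges by (auto simp: mono_indexed_edges_def)
    have "Suc n choose 2 \<le> card (?M e)" if e: "e \<in> edges G" for e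
    proof -
      have "(card (?Q e) - 1) choose 2 \<le> card (?M e)"
      proof (rule clique_mono_indexed_edges[OF f])
        show "?Q e \<noteq> {}"
          using Q(2)[OF e] by auto
        show "{d. d \<subseteq> ?Q e \<and> card d = 2} \<subseteq> edges ?H"
          using e edges by blast
      qed (use e Q QV in auto)
      then show ?thesis
        using Q(2)[OF e] by simp
    qed
    then have "card (edges G) * (Suc n choose 2) \<le> (\<Sum>e\<in>edges G. card (?M e))"
      using sum_mono[of "edges G" "\<lambda>_. Suc n choose 2"] by simp
    also have "\<dots> = card (\<Union>e\<in>edges G. ?M e)"
    proof (rule card_UN_disjoint[symmetric])
      show "\<forall>e\<in>edges G. \<forall>e'\<in>edges G. e \<noteq> e' \<longrightarrow> ?M e \<inter> ?M e' = {}"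
      proof (intro ballI impI)
        fix e e'
        assume e: "e \<in> edges G" "e' \<in> edges G" "e \<noteq> e'"
        have False if "d \<in> ?M e" "d \<in> ?M e'" for d
          by (rule disjoint_corona_cliques[of e e' d K]) (use that e card2 G in auto)
        then show "?M e \<inter> ?M e' = {}"
          by blast
      qed
    qed (use finE finM in auto)
    also have "\<dots> \<le> card (mono_indexed_edges ?H f)"
      using finM by (intro card_mono) auto
    finally show ?thesis .
  qed
  obtain x where x: "x \<in> verts K"
    using VK n by fastforce
  \<comment> \<open>A vertex of a copy has its clique as closed neighbourhood, so one such vertex from each
    copy gives an independent set that meets every clique once.\<close>
  let ?I = "{Inr (e, x) | e. e \<in> edges G}"
  have "\<exists>f. weak_iasi ?H f \<and> mono_indexed_edges ?H f = {d \<in> edges ?H. d \<inter> ?I = {}}"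
  proof (rule ex_weak_iasi_independent[OF finV])
    show "d \<subseteq> verts ?H \<and> card d = 2" if "d \<in> edges ?H" for d
      using that edges QV by blast
    show "\<not> d \<subseteq> ?I" if d: "d \<in> edges ?H" for d
    proof
      assume "d \<subseteq> ?I"
      moreover obtain e where "d \<subseteq> ?Q e" "card d = 2"
        using d edges by blast
      ultimately have "d \<subseteq> {Inr (e, x)}"
        by (auto simp: corona_clique_def)
      then show False
        using \<open>card d = 2\<close> card_mono[of "{Inr (e, x)}" d] by auto
    qed
  qed
  then obtain f where f: "weak_iasi ?H f"
    and mono: "mono_indexed_edges ?H f = {d \<in> edges ?H. d \<inter> ?I = {}}"
    by blast
  have upper: "card (mono_indexed_edges ?H f) \<le> card (edges G) * (Suc n choose 2)"
  proof -
    let ?S = "\<lambda>e. {d. d \<subseteq> ?Q e - {Inr (e, x)} \<and> card d = 2}"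
    have finS: "finite (?S e)" if "e \<in> edges G" for e
      using Q(1)[OF that] by auto
    have S: "card (?S e) = Suc n choose 2" if "e \<in> edges G" for e
    proof -
      have "Inr (e, x) \<in> ?Q e"
        using x by (auto simp: corona_clique_def)
      then show ?thesis
        using Q[OF that] by (simp add: n_subsets)
    qed
    have "mono_indexed_edges ?H f \<subseteq> (\<Union>e\<in>edges G. ?S e)"
      unfolding mono edges by auto
    then have "card (mono_indexed_edges ?H f) \<le> card (\<Union>e\<in>edges G. ?S e)"
      using finE finS by (intro card_mono) auto
    also have "\<dots> \<le> (\<Sum>e\<in>edges G. card (?S e))"
      using finE by (rule card_UN_le)
    also have "\<dots> = card (edges G) * (Suc n choose 2)"
      using S by simp
    finally show ?thesis .
  qed
  have "card (mono_indexed_edges ?H f) = card (edges G) * (Suc n choose 2)"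
    using upper lower[OF f] by simp
  then have "card (edges G) * (Suc n choose 2) \<in> {card (mono_indexed_edges ?H g) | g. weak_iasi ?H g}"
    using f by force
  then show ?thesis
    unfolding sparing_number_def using lower by (intro cInf_eq_minimum) auto
qed

text \<open>For \<open>m \<ge> 3\<close> the \<open>m\<close> edges in the definition are distinct: two of them could only
  coincide with reversed ends, which would require \<open>i + 2 = i\<close> modulo \<open>m\<close>.\<close>

lemma is_cycle_edges:
  assumes "is_cycle m C"
  shows "finite (verts C)" "card (edges C) = m"
    "\<And>e. e \<in> edges C \<Longrightarrow> e \<subseteq> verts C \<and> card e = 2"
proof -
  obtain c where m: "m \<ge> 3" and c: "bij_betw c {..<m} (verts C)"
    and E: "edges C = {{c i, c (Suc i mod m)} | i. i < m}"
    using assms by (auto simp: is_cycle_def)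
  show "finite (verts C)"
    using c bij_betw_finite by blast
  have c_eq: "c i = c j \<longleftrightarrow> i = j" if "i < m" "j < m" for i j
    using c that by (auto simp: bij_betw_def inj_on_def)
  have c_in: "c i \<in> verts C" if "i < m" for i
    using c that by (auto simp: bij_betw_def)
  have next_less: "Suc i mod m < m" for i
    using m by simp
  have next_ne: "Suc i mod m \<noteq> i" if "i < m" for i
    using that m by (auto simp: mod_Suc)
  show "e \<subseteq> verts C \<and> card e = 2" if "e \<in> edges C" for e
  proof -
    obtain i where i: "i < m" "e = {c i, c (Suc i mod m)}"
      using \<open>e \<in> edges C\<close> unfolding E by blast
    then have "c i \<noteq> c (Suc i mod m)"
      using c_eq[OF i(1) next_less] next_ne[OF i(1)] by auto
    then show ?thesis
      using i c_in next_less by auto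
  qed
  have "inj_on (\<lambda>i. {c i, c (Suc i mod m)}) {..<m}"
  proof (rule inj_onI)
    fix i j
    assume ij: "i \<in> {..<m}" "j \<in> {..<m}"
      and "{c i, c (Suc i mod m)} = {c j, c (Suc j mod m)}"
    then have "i = j \<or> i = Suc j mod m \<and> Suc i mod m = j"
      using c_eq next_less by (auto simp: doubleton_eq_iff)
    moreover have "\<not> (i = Suc j mod m \<and> Suc i mod m = j)"
      using ij m by (auto simp: mod_Suc split: if_splits)
    ultimately show "i = j"
      by blast
  qed
  moreover have "edges C = (\<lambda>i. {c i, c (Suc i mod m)}) ` {..<m}"
    using E by auto
  ultimately show "card (edges C) = m"
    by (simp add: card_image)
qed

theorem theorem2p12:
  fixes C :: "'a graph" and K :: "'b graph" and m n :: nat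
  assumes "is_cycle m C" and "is_complete n K" and "n \<ge> 1"
  shows "real (sparing_number (edge_corona C K)) = 1 / 2 * real m * real n * (real n + 1)"
proof -
  have "sparing_number (edge_corona C K) = m * (Suc n choose 2)"
    using sparing_number_edge_corona_complete[of C n K] is_cycle_edges[OF assms(1)] assms
    by simp
  moreover have "2 * (Suc n choose 2) = n * Suc n"
    by (simp add: choose_two)
  then have "2 * real (Suc n choose 2) = real n * (real n + 1)"
    by (metis of_nat_Suc of_nat_mult of_nat_numeral add.commute)
  ultimately show ?thesis
    by simp
qed

end
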